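(* Let $d \geqslant 1$, let $A \subset \mathbb{Z}^d$ be a finite set such that $H(A)$ is a $d$-simplex, and let $a_0 \in A$. Consider, for an integer $N \geqslant 1$, the identity $$(\ast)_N \qquad NA = \bigl(N H(A) \cap (a_0 N + \Lambda_{A-A})\bigr) \setminus \Bigl(\bigcup_{a \in \operatorname{ex}(H(A))} \bigl(aN - \mathcal{E}(a-A)\bigr)\Bigr).$$ Then $(\ast)_N$ holds for all integers $N \geqslant 1$ for which $$N \geqslant (d+1)!\operatorname{vol}(H(A)) - (d+1)(|A| - d).$$ Moreover, if $|A| = d+1$ or $|A| = d+2$, then $(\ast)_N$ holds for all integers $N \geqslant 1$.
   Context: For a positive integer $N$, $NA := \{a_1 + \cdots + a_N : a_i \in A\}$. $H(A)$ is the convex hull of $A$ in $\mathbb{R}^d$, $NH(A) = \{Nx : x \in H(A)\}$, and $\operatorname{vol}$ is $d$-dimensional Lebesgue measure. $H(A)$ is called a $d$-simplex if there exists $B \subset A$ with $|B| = d+1$ such that $B - B$ spans $\mathbb{R}^d$ and $H(A) = H(B)$ (in which case $\operatorname{ex}(H(A)) = B$). $\operatorname{ex}(H(A))$ is the set of extremal points of $H(A)$: those $p \in H(A)$ for which there are $v \in \operatorname{span}(A-A)\setminus\{0\}$ and a constant $c$ with $\langle v,p\rangle = c$ and $\langle v,x\rangle > c$ for all $x \in H(A)\setminus\{p\}$. Here $A - A = \{a-a' : a,a' \in A\}$ and $a - A = \{a - a' : a' \in A\}$. For a finite set $S \subset \mathbb{Z}^d$, $\Lambda_S$ is the subgroup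 of $\mathbb{Z}^d$ generated by $S$. For a finite set $S \subset \mathbb{Z}^d$ with $0 \in S$: $C_S := \{\sum_{s\in S} c_s s : c_s \in \mathbb{R}_{\geqslant 0}\}$, $\mathcal{P}(S) := \bigcup_{N\geqslant 1} NS$, and $\mathcal{E}(S) := (C_S \cap \Lambda_S)\setminus \mathcal{P}(S)$. Also $aN - \mathcal{E}(a-A) = \{aN - e : e \in \mathcal{E}(a-A)\}$. *)

theory Defs
  imports "HOL-Analysis.Analysis" "HOL-Computational_Algebra.Group_Closure"
begin

text \<open>The lattice of integer vectors, as a subset of Euclidean space; finite subsets of it are
  treated as sets of real vectors, so that convex hulls, spans, and volumes apply to them directly.\<close>

definition int_lattice :: "(real ^ 'n) set" where
  "int_lattice = {x. \<forall>i. x $ i \<in> \<int>}"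

definition sumset :: "nat \<Rightarrow> 'a::comm_monoid_add set \<Rightarrow> 'a set" where
  "sumset N A = {(\<Sum>i<N. f i) | f. \<forall>i<N. f i \<in> A}"

definition diff_set :: "'a::ab_group_add set \<Rightarrow> 'a set" where
  "diff_set A = {a - a' | a a'. a \<in> A \<and> a' \<in> A}"

definition hull_is_full_simplex :: "(real ^ 'n) set \<Rightarrow> bool" where
  "hull_is_full_simplex A \<longleftrightarrow>
     (\<exists>B\<subseteq>A. finite B \<and> card B = CARD('n) + 1 \<and> span (diff_set B) = UNIV \<and>
        convex hull A = convex hull B)"

text \<open>The extremal points of the convex hull of \<open>A\<close> are its exposed points, with the exposing
  direction taken in the real span of \<open>A - A\<close>.\<close>

definition hull_extremal_points :: "'a::euclidean_space set \<Rightarrow> 'a set" where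
  "hull_extremal_points A =
     {p \<in> convex hull A. \<exists>v \<in> span (diff_set A) - {0}. \<exists>c::real.
        v \<bullet> p = c \<and> (\<forall>x \<in> convex hull A - {p}. v \<bullet> x > c)}"

definition nonneg_cone :: "'a::real_vector set \<Rightarrow> 'a set" where
  "nonneg_cone S = {(\<Sum>s\<in>S. c s *\<^sub>R s) | c. \<forall>s\<in>S. c s \<ge> (0::real)}"

definition all_sumsets :: "'a::comm_monoid_add set \<Rightarrow> 'a set" where
  "all_sumsets S = (\<Union>N\<in>{1..}. sumset N S)"

text \<open>The exceptional set of a finite \<open>S\<close>. Here \<open>group_closure S\<close> is the additive subgroup
  generated by \<open>S\<close>.\<close>

definition exceptional_set :: "'a::real_vector set \<Rightarrow> 'a set" where
  "exceptional_set S = (nonneg_cone S \<inter> group_closure S) - all_sumsets S"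

definition sumset_structure :: "(real ^ 'n) set \<Rightarrow> real ^ 'n \<Rightarrow> nat \<Rightarrow> bool" where
  "sumset_structure A a\<^sub>0 N \<longleftrightarrow>
     sumset N A =
       ((\<lambda>x. real N *\<^sub>R x) ` (convex hull A) \<inter>
        (\<lambda>x. real N *\<^sub>R a\<^sub>0 + x) ` group_closure (diff_set A)) -
       (\<Union>a \<in> hull_extremal_points A.
          (\<lambda>e. real N *\<^sub>R a - e) ` exceptional_set ((\<lambda>a'. a - a') ` A))"

end

theory Submission
  imports Defs
begin

text \<open>
  The inclusion of the sumset in the set on the right-hand side is elementary
  (\<open>sumset_subset_structure\<close>).  For the converse, lift \<open>x\<close> at level \<open>N\<close> to the cone over the simplex
  and use the vertices as a basis there.  In these coordinates the \<open>d + 1\<close> vertices are the unit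
  vectors, the other elements of \<open>A\<close> form a set \<open>T\<close> (called \<open>inner_coords\<close> below) of nonzero
  vectors with coordinates in \<open>[0, 1)\<close>,
  the sum of the coordinates is the level, and \<open>x\<close> lies in the sumset iff its coordinate vector \<open>w\<close>
  lies in the semigroup generated by the unit vectors and \<open>T\<close> (\<open>sumset_iff_semigroup\<close>).  That \<open>x\<close>
  avoids the exceptional set of the \<open>i\<close>-th vertex means that \<open>w\<close> enters this semigroup after adding
  enough copies of the \<open>i\<close>-th unit vector (\<open>saturated_point_lifts\<close>).

  Let \<open>m\<close> be \<open>d!\<close> times the volume of the simplex.  It is the volume of a fundamental parallelepiped
  of the lattice spanned by the edges, hence bounds the number of classes of lattice points modulo the
  lattice of the vertices (\<open>card_incongruent_le_volume\<close>).  A pigeonhole argument on partial sums shows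
  that a sum of elements of \<open>T\<close> can be replaced, at the cost of unit vectors only, by one with at most
  \<open>m - card T\<close> summands (\<open>shorten_sequence\<close>).  If \<open>w\<close> were outside the semigroup, the \<open>i\<close>-th unit
  vector would occur with a negative coefficient in a representation with few summands from \<open>T\<close>, which
  forces \<open>w $ i < m - card T - 1\<close>.  This for all \<open>i\<close> bounds the level strictly by
  \<open>(d + 1) * (m - card T - 1)\<close>, which with \<open>card T = card A - d - 1\<close> is exactly the threshold
  (\<open>in_generated_semigroup_if_high\<close>).

  If \<open>card A \<le> d + 2\<close>, then \<open>T\<close> has at most one element.  Of the representations of \<open>w\<close> for two different
  vertices, the one in which this element occurs less often then has no negative coefficient (\<open>in_generated_semigroup_if_one_generator\<close>).
\<close>

section \<open>Volume and linear bijections\<close>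

lemma nn_integral_lborel_translate:
  fixes a :: "'a::euclidean_space"
  assumes [measurable]: "F \<in> borel_measurable borel"
  shows "(\<integral>\<^sup>+x. F (a + x) \<partial>lborel) = (\<integral>\<^sup>+x. F x \<partial>lborel)"
proof -
  have "(\<integral>\<^sup>+x. F (a + x) \<partial>lborel) = (\<integral>\<^sup>+x. F x \<partial>(distr lborel borel ((+) a)))"
    by (subst nn_integral_distr) auto
  then show ?thesis by (simp add: lborel_distr_plus)
qed

lemma nn_integral_lborel_reflect:
  fixes a :: "'a::euclidean_space"
  assumes [measurable]: "F \<in> borel_measurable borel"
  shows "(\<integral>\<^sup>+x. F (a - x) \<partial>lborel) = (\<integral>\<^sup>+x. F x \<partial>lborel)"
proof -
  have eq: "lborel = distr lborel borel (\<lambda>x. a - x)"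
    using lborel_affine[of "-1" a] by (simp add: density_1)
  have "(\<integral>\<^sup>+x. F (a - x) \<partial>lborel) = (\<integral>\<^sup>+x. F x \<partial>(distr lborel borel (\<lambda>x. a - x)))"
    by (subst nn_integral_distr) auto
  then show ?thesis by (simp flip: eq)
qed

lemma emeasure_lborel_translate:
  fixes a :: "'a::euclidean_space"
  assumes [measurable]: "X \<in> sets borel"
  shows "emeasure lborel {x. a + x \<in> X} = emeasure lborel X"
proof -
  have "emeasure lborel {x. a + x \<in> X} = (\<integral>\<^sup>+x. indicator {x. a + x \<in> X} x \<partial>lborel)"
    by (rule nn_integral_indicator[symmetric]) measurable
  also have "\<dots> = (\<integral>\<^sup>+x. indicator X (a + x) \<partial>lborel)"
    by (simp add: indicator_def)
  finally show ?thesis by (simp add: nn_integral_lborel_translate)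
qed

text \<open>A linear bijection scales all volumes by one and the same factor.  This is the uniqueness of a
  translation-invariant measure, in the symmetric form that avoids division: with \<open>g\<close> the inverse
  of \<open>f\<close>, both sides are the integral of the indicator of \<open>{(x, y). g x \<in> S \<and> g x + y \<in> T}\<close>,
  evaluated in the two possible orders.\<close>

lemma emeasure_linear_image_cross:
  fixes f :: "'a::euclidean_space \<Rightarrow> 'a"
  assumes "linear f" and "inj f" and [measurable]: "S \<in> sets borel" "T \<in> sets borel"
  shows "emeasure lborel (f ` S) * emeasure lborel T = emeasure lborel (f ` T) * emeasure lborel S"
proof -
  obtain g where g: "linear g" "\<And>x. g (f x) = x" "\<And>x. f (g x) = x"
    using linear_injective_isomorphism[OF assms(1,2)] by blast
  have [measurable]: "f \<in> borel_measurable borel" "g \<in> borel_measurable borel"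
    using assms(1) g(1)
    by (auto intro!: borel_measurable_continuous_onI linear_continuous_on simp: linear_conv_bounded_linear)
  have im: "f ` X = g -` X" for X
    using g(2,3) by (auto simp: image_iff) metis
  have imI: "indicator X (g x) = (indicator (f ` X) x :: ennreal)" for X x
    by (simp add: im indicator_def)
  have sets[measurable]: "f ` X \<in> sets borel" if "X \<in> sets borel" for X
    unfolding im using that measurable_sets_borel[OF \<open>g \<in> borel_measurable borel\<close>] by simp
  note [measurable] = sets[OF assms(3)] sets[OF assms(4)]
  have "emeasure lborel (f ` S) * emeasure lborel T =
      (\<integral>\<^sup>+x. indicator (f ` S) x * (\<integral>\<^sup>+y. indicator T (g x + y) \<partial>lborel) \<partial>lborel)"
    by (subst nn_integral_lborel_translate) (auto simp: nn_integral_multc)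
  also have "\<dots> = (\<integral>\<^sup>+x. (\<integral>\<^sup>+y. indicator S (g x) * indicator T (g x + y) \<partial>lborel) \<partial>lborel)"
    by (simp add: nn_integral_cmult imI)
  also have "\<dots> = (\<integral>\<^sup>+y. (\<integral>\<^sup>+x. indicator S (g x) * indicator T (g x + y) \<partial>lborel) \<partial>lborel)"
    by (rule lborel_pair.Fubini') auto
  \<comment> \<open>Translating \<open>x\<close> by \<open>f y\<close> turns \<open>g x\<close> into \<open>g x + y\<close>.\<close>
  also have "\<dots> = (\<integral>\<^sup>+y. (\<integral>\<^sup>+x. indicator S (g x - y) * indicator T (g x) \<partial>lborel) \<partial>lborel)"
  proof (rule nn_integral_cong)
    fix y :: 'a
    show "(\<integral>\<^sup>+x. indicator S (g x) * indicator T (g x + y) \<partial>lborel) =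
        (\<integral>\<^sup>+x. indicator S (g x - y) * (indicator T (g x) :: ennreal) \<partial>lborel)"
      using nn_integral_lborel_translate[of "\<lambda>x. indicator S (g x - y) * (indicator T (g x) :: ennreal)" "f y"]
      by (simp add: linear_add[OF g(1)] g(2) add.commute)
  qed
  also have "\<dots> = (\<integral>\<^sup>+x. (\<integral>\<^sup>+y. indicator S (g x - y) * indicator T (g x) \<partial>lborel) \<partial>lborel)"
    by (rule lborel_pair.Fubini') auto
  also have "\<dots> = (\<integral>\<^sup>+x. (\<integral>\<^sup>+y. indicator S (g x - y) \<partial>lborel) * indicator (f ` T) x \<partial>lborel)"
    by (simp add: nn_integral_multc imI)
  also have "\<dots> = emeasure lborel (f ` T) * emeasure lborel S"
    by (subst nn_integral_lborel_reflect) (auto simp: nn_integral_cmult mult.commute)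
  finally show ?thesis .
qed

section \<open>Incongruent integer points and the fundamental parallelepiped\<close>

definition half_open_cube :: "(real ^ 'n) set" where
  "half_open_cube = {x. \<forall>i. 0 \<le> x $ i \<and> x $ i < 1}"

lemma half_open_cube_borel [measurable]: "half_open_cube \<in> sets borel"
  unfolding half_open_cube_def by measurable

lemma emeasure_half_open_cube: "emeasure lborel (half_open_cube :: (real ^ 'n) set) = 1"
proof -
  have 1: "emeasure lborel (cbox 0 (1::real^'n)) = 1"
    by (subst emeasure_lborel_cbox) (auto simp: Basis_vec_def inner_axis intro!: prod.neutral)
  have 2: "emeasure lborel (box 0 (1::real^'n)) = 1"
    by (subst emeasure_lborel_box) (auto simp: Basis_vec_def inner_axis intro!: prod.neutral)
  have "emeasure lborel (half_open_cube :: (real ^ 'n) set) \<le> emeasure lborel (cbox 0 (1::real^'n))"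
    by (rule emeasure_mono) (auto simp: half_open_cube_def mem_box_cart less_imp_le)
  moreover have "emeasure lborel (box 0 (1::real^'n)) \<le> emeasure lborel (half_open_cube :: (real ^ 'n) set)"
    by (rule emeasure_mono) (auto simp: half_open_cube_def mem_box_cart less_imp_le)
  ultimately show ?thesis using 1 2 by simp
qed

lemma int_lattice_diff: "x \<in> int_lattice \<Longrightarrow> y \<in> int_lattice \<Longrightarrow> x - y \<in> int_lattice"
  by (simp add: int_lattice_def)

lemma half_open_cube_congruent_eq:
  assumes "x \<in> half_open_cube" "y \<in> half_open_cube" "x - y \<in> int_lattice"
  shows "x = y"
proof -
  have "x $ i = y $ i" for i
  proof -
    obtain k :: int where "x $ i - y $ i = of_int k"
      using assms(3) by (auto simp: int_lattice_def elim!: Ints_cases)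
    moreover have "\<bar>x $ i - y $ i\<bar> < 1"
      using assms(1,2) by (auto simp: half_open_cube_def abs_less_iff) (smt (verit))+
    ultimately have "\<bar>of_int k :: real\<bar> < 1" by metis
    then have "k = 0" by linarith
    with \<open>x $ i - y $ i = of_int k\<close> show ?thesis by simp
  qed
  then show ?thesis by (simp add: vec_eq_iff)
qed

lemma half_open_cube_representative:
  "\<exists>z \<in> int_lattice. x - z \<in> half_open_cube"
  by (rule bexI[of _ "\<chi> i. of_int \<lfloor>x $ i\<rfloor>"])
    (auto simp: half_open_cube_def int_lattice_def, linarith+)

lemma countable_int_lattice: "countable (int_lattice :: (real ^ 'n) set)"
proof -
  have "int_lattice \<subseteq> (\<lambda>h. \<chi> i. of_int (h i)) ` (UNIV :: ('n \<Rightarrow> int) set)"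
  proof
    fix x :: "real ^ 'n" assume "x \<in> int_lattice"
    then have "x = (\<chi> i. of_int \<lfloor>x $ i\<rfloor>)"
      by (auto simp: int_lattice_def vec_eq_iff)
    then show "x \<in> (\<lambda>h. \<chi> i. of_int (h i)) ` (UNIV :: ('n \<Rightarrow> int) set)" 
      by (intro image_eqI[where x = "\<lambda>i. \<lfloor>x $ i\<rfloor>"]) auto
  qed
  then show ?thesis by (rule countable_subset) auto
qed

text \<open>The translates \<open>y + Q\<close> of the half-open unit cube \<open>Q\<close> by the points of \<open>Y\<close> have total volume
  \<open>card Y\<close>.  The translates \<open>f z + f ` Q\<close> with \<open>z\<close> integral tile the space; cutting \<open>y + Q\<close> along
  this tiling and moving every piece back into \<open>f ` Q\<close> produces a set \<open>V y\<close> of volume 1.  If \<open>V y\<close>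
  and \<open>V y'\<close> met, then \<open>y - y'\<close> would lie in \<open>f ` int_lattice\<close>; so incongruent points give disjoint
  subsets of \<open>f ` Q\<close>.  In other words, the index of the lattice \<open>f ` int_lattice\<close> is at most the
  volume of its fundamental parallelepiped.\<close>

lemma card_incongruent_le:
  fixes f :: "real ^ 'n \<Rightarrow> real ^ 'n"
  assumes f: "linear f" "inj f" and lat: "f ` int_lattice \<subseteq> int_lattice"
    and Y: "finite Y" "Y \<subseteq> int_lattice"
    and inc: "\<And>x y. x \<in> Y \<Longrightarrow> y \<in> Y \<Longrightarrow> x - y \<in> f ` int_lattice \<Longrightarrow> x = y"
  shows "of_nat (card Y) \<le> emeasure lborel (f ` half_open_cube)"
proof -
  define Q :: "(real ^ 'n) set" where "Q = half_open_cube"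
  obtain g where g: "linear g" "\<And>x. g (f x) = x" "\<And>x. f (g x) = x"
    using linear_injective_isomorphism[OF f] by blast
  have [measurable]: "g \<in> borel_measurable borel"
    using g(1)
    by (auto intro!: borel_measurable_continuous_onI linear_continuous_on simp: linear_conv_bounded_linear)
  have im: "f ` X = g -` X" for X
    using g(2,3) by (auto simp: image_iff) metis
  have Qm[measurable]: "Q \<in> sets borel" by (simp add: Q_def)
  have fQ[measurable]: "f ` Q \<in> sets borel"
    unfolding im using measurable_sets_borel[OF \<open>g \<in> borel_measurable borel\<close> Qm] by simp
  define piece where "piece y z = {x. x \<in> f ` Q \<and> x + f z - y \<in> Q}" for y z
  have pm[measurable]: "piece y z \<in> sets borel" for y z
    unfolding piece_def by measurable
  define V where "V y = (\<Union>z\<in>int_lattice. piece y z)" for y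
  have Vm: "V y \<in> sets borel" for y
    unfolding V_def using countable_int_lattice pm by (intro sets.countable_UN') auto
  have V1: "emeasure lborel (V y) = 1" for y
  proof -
    \<comment> \<open>The piece of \<open>y + Q\<close> in the tile of \<open>z\<close>, before it is moved by \<open>- f z\<close>.\<close>
    define shifted where "shifted z = {x. x - f z \<in> f ` Q \<and> x - y \<in> Q}" for z
    have sm: "shifted z \<in> sets borel" for z
      unfolding shifted_def by measurable
    have eq: "emeasure lborel (piece y z) = emeasure lborel (shifted z)" for z
      using emeasure_lborel_translate[OF sm[of z], of "f z"]
      by (simp add: piece_def shifted_def add.commute)
    have dp: "disjoint_family_on (piece y) int_lattice"
    proof (unfold disjoint_family_on_def, intro ballI impI)
      fix z z' :: "real ^ 'n" assume zz: "z \<in> int_lattice" "z' \<in> int_lattice" "z \<noteq> z'"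
      show "piece y z \<inter> piece y z' = {}"
      proof (rule ccontr)
        assume "\<not> ?thesis"
        then obtain x where x: "x + f z - y \<in> Q" "x + f z' - y \<in> Q" by (auto simp: piece_def)
        have "f z - f z' \<in> int_lattice"
          using lat zz by (intro int_lattice_diff) auto
        then have "(x + f z - y) - (x + f z' - y) \<in> int_lattice" by simp
        from half_open_cube_congruent_eq[OF _ _ this] x have "f z = f z'" by (simp add: Q_def)
        with zz f(2) show False by (auto dest: injD)
      qed
    qed
    have ds: "disjoint_family_on shifted int_lattice"
    proof (unfold disjoint_family_on_def, intro ballI impI)
      fix z z' :: "real ^ 'n" assume zz: "z \<in> int_lattice" "z' \<in> int_lattice" "z \<noteq> z'"
      show "shifted z \<inter> shifted z' = {}"
      proof (rule ccontr)
        assume "\<not> ?thesis"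
        then obtain x where x: "g (x - f z) \<in> Q" "g (x - f z') \<in> Q" by (auto simp: shifted_def im)
        have "g (x - f z) - g (x - f z') \<in> int_lattice"
          using zz int_lattice_diff by (auto simp: linear_diff[OF g(1)] g(2))
        from half_open_cube_congruent_eq[OF _ _ this] x have "z = z'"
          by (simp add: Q_def linear_diff[OF g(1)] g(2))
        with zz show False by simp
      qed
    qed
    have cover: "(\<Union>z\<in>int_lattice. shifted z) = (+) y ` Q"
    proof (intro equalityI subsetI)
      fix x assume "x \<in> (+) y ` Q"
      then have "x - y \<in> Q" by auto
      moreover obtain z where "z \<in> int_lattice" "g x - z \<in> Q"
        using half_open_cube_representative[of "g x"] by (auto simp: Q_def)
      ultimately show "x \<in> (\<Union>z\<in>int_lattice. shifted z)"
        by (auto simp: shifted_def im linear_diff[OF g(1)] g(2))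
    qed (auto simp: shifted_def image_iff algebra_simps intro!: bexI[of _ "_ - y"])
    have "emeasure lborel (V y) = (\<integral>\<^sup>+z. emeasure lborel (piece y z) \<partial>count_space int_lattice)"
      unfolding V_def using pm dp countable_int_lattice by (intro emeasure_UN_countable) auto
    also have "\<dots> = emeasure lborel (\<Union>z\<in>int_lattice. shifted z)"
      unfolding eq using sm ds countable_int_lattice by (intro emeasure_UN_countable[symmetric]) auto
    also have "\<dots> = emeasure lborel {x. - y + x \<in> Q}"
      unfolding cover by (rule arg_cong[of _ _ "emeasure lborel"]) (force simp: image_iff)
    also have "\<dots> = emeasure lborel Q"
      by (rule emeasure_lborel_translate[OF Qm])
    finally show ?thesis by (simp add: Q_def emeasure_half_open_cube)
  qed
  have dV: "disjoint_family_on V Y"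
  proof (unfold disjoint_family_on_def, intro ballI impI)
    fix y y' assume yy: "y \<in> Y" "y' \<in> Y" "y \<noteq> y'"
    show "V y \<inter> V y' = {}"
    proof (rule ccontr)
      assume "\<not> ?thesis"
      then obtain x z z' where x: "z \<in> int_lattice" "z' \<in> int_lattice"
          "x + f z - y \<in> Q" "x + f z' - y' \<in> Q" by (auto simp: V_def piece_def)
      have "(x + f z - y) - (x + f z' - y') = (f z - f z') - (y - y')" by simp
      also have "\<dots> \<in> int_lattice"
        using lat x yy Y by (intro int_lattice_diff) auto
      finally have "f z - y = f z' - y'"
        using half_open_cube_congruent_eq[of "x + f z - y" "x + f z' - y'"] x by (simp add: Q_def)
      then have "y - y' = f (z - z')" by (simp add: linear_diff[OF f(1)] algebra_simps)
      with inc[OF yy(1,2)] x int_lattice_diff yy(3) show False by blast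
    qed
  qed
  have "of_nat (card Y) = (\<Sum>y\<in>Y. emeasure lborel (V y))" by (simp add: V1)
  also have "\<dots> = emeasure lborel (\<Union>y\<in>Y. V y)"
    using Vm dV Y(1) by (intro sum_emeasure) auto
  also have "\<dots> \<le> emeasure lborel (f ` Q)"
    by (rule emeasure_mono) (auto simp: V_def piece_def)
  finally show ?thesis by (simp add: Q_def)
qed

text \<open>The standard simplex has volume \<open>1 / n!\<close>, and the ratio of volumes survives a linear bijection.\<close>

lemma emeasure_linear_image_std_simplex:
  fixes f :: "real ^ 'n \<Rightarrow> real ^ 'n"
  assumes "linear f" "inj f"
  shows "emeasure lborel (f ` half_open_cube)
    = fact CARD('n) * emeasure lborel (f ` (convex hull (insert 0 Basis)))"
proof -
  let ?D = "convex hull (insert 0 Basis) :: (real ^ 'n) set"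
  have "?D \<in> sets borel" by (intro borel_compact finite_imp_compact_convex_hull) auto
  from emeasure_linear_image_cross[OF assms half_open_cube_borel this]
  have "emeasure lborel (f ` ?D) = emeasure lborel (f ` half_open_cube) * ennreal (1 / fact CARD('n))"
    by (simp add: emeasure_std_simplex emeasure_half_open_cube)
  then have "fact CARD('n) * emeasure lborel (f ` ?D) =
     emeasure lborel (f ` half_open_cube) * (fact CARD('n) * ennreal (1 / fact CARD('n)))"
    by (simp add: ac_simps)
  also have "fact CARD('n) * ennreal (1 / fact CARD('n)) = 1"
    by (simp flip: ennreal_fact ennreal_mult)
  finally show ?thesis by simp
qed

section \<open>Shortest representations modulo the integers\<close>

definition nat_lattice :: "(real ^ 'k) set" where
  "nat_lattice = {x. \<forall>i. x $ i \<in> \<nat>}"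

text \<open>These are the barycentric coordinates that points of a simplex other than its vertices can have.
  A nonnegative vector that is congruent to such a vector modulo the integers exceeds it by a
  nonnegative integer vector, because no integer lies strictly between \<open>-1\<close> and \<open>0\<close>.\<close>

definition fractional :: "(real ^ 'k) set \<Rightarrow> bool" where
  "fractional T \<longleftrightarrow> (\<forall>t\<in>T. t \<noteq> 0 \<and> (\<forall>i. 0 \<le> t $ i \<and> t $ i < 1))"

definition incongruent :: "(real ^ 'k) set \<Rightarrow> bool" where
  "incongruent Y \<longleftrightarrow> (\<forall>x\<in>Y. \<forall>y\<in>Y. x - y \<in> int_lattice \<longrightarrow> x = y)"

lemma nat_lattice_add: "x \<in> nat_lattice \<Longrightarrow> y \<in> nat_lattice \<Longrightarrow> x + y \<in> nat_lattice"
  by (simp add: nat_lattice_def)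

lemma zero_in_nat_lattice: "0 \<in> nat_lattice"
  by (simp add: nat_lattice_def)

lemma nat_lattice_iff: "x \<in> nat_lattice \<longleftrightarrow> x \<in> int_lattice \<and> (\<forall>i. x $ i > -1)"
proof
  assume "x \<in> int_lattice \<and> (\<forall>i. x $ i > -1)"
  then have *: "x $ i \<in> \<int>" "x $ i > -1" for i by (auto simp: int_lattice_def)
  have "x $ i \<in> \<nat>" for i
  proof -
    obtain k :: int where k: "x $ i = of_int k" using *(1)[of i] by (auto elim: Ints_cases)
    with *(2)[of i] have "k \<ge> 0" by simp
    then show ?thesis using k by (metis of_nat_in_Nats of_nat_nat)
  qed
  then show "x \<in> nat_lattice" by (simp add: nat_lattice_def)
next
  assume "x \<in> nat_lattice"
  then have *: "x $ i \<in> \<nat>" for i by (simp add: nat_lattice_def)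
  have "x $ i \<in> \<int>" "x $ i > -1" for i
    using *[of i] by (auto elim!: Nats_cases)
  then show "x \<in> int_lattice \<and> (\<forall>i. x $ i > -1)" by (simp add: int_lattice_def)
qed

lemma sum_list_fractional_nonneg:
  assumes "fractional T" "set xs \<subseteq> T"
  shows "0 \<le> sum_list xs $ i"
  using assms(2)
proof (induction xs)
  case (Cons a xs)
  then show ?case using assms(1) by (auto simp: fractional_def)
qed simp

lemma sum_list_fractional_less:
  assumes "fractional T" "set xs \<subseteq> T" "xs \<noteq> []"
  shows "sum_list xs $ i < length xs"
  using assms(2,3)
proof (induction xs)
  case (Cons a xs)
  then show ?case using assms(1) by (cases "xs = []") (auto simp: fractional_def add_strict_mono)
qed simp

lemma int_lattice_minus_commute: "x - y \<in> int_lattice \<longleftrightarrow> y - x \<in> int_lattice"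
proof -
  have "x - y \<in> int_lattice" if "y - x \<in> int_lattice" for x y :: "real ^ 'k"
  proof -
    have "x $ i - y $ i \<in> \<int>" for i
      using that Ints_minus[of "y $ i - x $ i"] by (simp add: int_lattice_def)
    then show ?thesis by (simp add: int_lattice_def)
  qed
  then show ?thesis by blast
qed

text \<open>Take a shortest \<open>ys\<close>, and let \<open>s k\<close> be the sum of its first \<open>k\<close> entries.  If the sum of a block
  of \<open>ys\<close> were congruent modulo the integers to some \<open>u \<in> insert 0 T\<close>, then, because \<open>u\<close> has
  coordinates below 1 and the block sum has nonnegative ones, they would differ by a nonnegative
  integer vector, and the block could be replaced by \<open>[u]\<close> or \<open>[]\<close>.  Hence no nonempty block is
  congruent to \<open>0\<close> and no block of length at least 2 is congruent to an element of \<open>T\<close>, which makes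
  \<open>0\<close>, the elements of \<open>T\<close> and \<open>s 2, ..., s K\<close> pairwise incongruent, where \<open>K\<close> is the length of
  \<open>ys\<close>.  There are \<open>K + card T\<close> of them.  Counting \<open>T\<close> among the classes is what improves the usual
  bound for the length of a zero-sum-free sequence.\<close>

lemma shorten_sequence:
  fixes T \<Gamma> :: "(real ^ 'k) set"
  assumes T: "finite T" "fractional T" "T \<subseteq> \<Gamma>"
    and \<Gamma>: "0 \<in> \<Gamma>" "\<And>x y. x \<in> \<Gamma> \<Longrightarrow> y \<in> \<Gamma> \<Longrightarrow> x + y \<in> \<Gamma>"
    and m: "\<And>Y. finite Y \<Longrightarrow> Y \<subseteq> \<Gamma> \<Longrightarrow> incongruent Y \<Longrightarrow> real (card Y) \<le> m"
    and xs: "set xs \<subseteq> T"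
  obtains ys where "set ys \<subseteq> T" "sum_list xs - sum_list ys \<in> nat_lattice"
    and "real (length ys) + real (card T) \<le> m \<or> ys = []"
proof -
  define P where "P ys \<longleftrightarrow> set ys \<subseteq> T \<and> sum_list xs - sum_list ys \<in> nat_lattice" for ys
  have "P xs" using xs by (simp add: P_def zero_in_nat_lattice)
  then obtain ys where ys: "P ys" and min: "\<And>zs. P zs \<Longrightarrow> length ys \<le> length zs"
    by (metis arg_min_nat_lemma)
  have setys: "set ys \<subseteq> T" using ys by (simp add: P_def)
  \<comment> \<open>Replacing a block of \<open>ys\<close> by a shorter block that differs from it by a
    nonnegative integer vector would contradict minimality.\<close>
  have block: "length us \<le> length zs"
    if "ys = ps @ us @ vs" "set zs \<subseteq> T" "sum_list us - sum_list zs \<in> nat_lattice" for ps us vs zs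
  proof -
    have "sum_list xs - sum_list (ps @ zs @ vs) =
        (sum_list xs - sum_list ys) + (sum_list us - sum_list zs)"
      using that(1) by simp
    also have "\<dots> \<in> nat_lattice"
      using ys that(3) by (intro nat_lattice_add) (auto simp: P_def)
    finally have "P (ps @ zs @ vs)" using setys that by (auto simp: P_def)
    from min[OF this] show ?thesis using that(1) by simp
  qed
  have promote: "sum_list us - u \<in> nat_lattice"
    if "set us \<subseteq> T" "u \<in> insert 0 T" "sum_list us - u \<in> int_lattice" for us u
    unfolding nat_lattice_iff
  proof (intro conjI allI)
    fix i
    have "u $ i < 1" using that(2) T(2) by (auto simp: fractional_def)
    with sum_list_fractional_nonneg[OF T(2) that(1), of i] show "- 1 < (sum_list us - u) $ i"
      by simp
  qed (fact that(3))
  show ?thesis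
  proof (cases "ys = []")
    case True
    show ?thesis by (rule that[of ys]) (use ys True in \<open>auto simp: P_def\<close>)
  next
    case False
    define K where "K = length ys"
    have K: "K \<ge> 1" using False by (cases ys) (auto simp: K_def)
    define s where "s k = sum_list (take k ys)" for k
    have later: "s l - s k \<notin> int_lattice" if "k < l" "l \<le> K" for k l
    proof
      assume int: "s l - s k \<in> int_lattice"
      define us where "us = drop k (take l ys)"
      have tl: "take l ys = take k ys @ us"
        using that by (metis us_def append_take_drop_id min.absorb1 order_less_imp_le take_take)
      have us: "s l - s k = sum_list us" "ys = take k ys @ us @ drop l ys" "us \<noteq> []" "set us \<subseteq> T"
        unfolding s_def tl subgoal by simp
        subgoal using tl by (metis append.assoc append_take_drop_id)
        subgoal using that by (simp add: us_def K_def)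
        subgoal using setys by (auto simp: us_def dest: in_set_dropD in_set_takeD)
        done
      have "sum_list us - 0 \<in> nat_lattice" by (rule promote) (use us int in auto)
      then have "length us \<le> 0" using block[OF us(2), of "[]"] by simp
      with us(3) show False by simp
    qed
    have early: "s k - u \<notin> int_lattice" if "2 \<le> k" "k \<le> K" "u \<in> insert 0 T" for k u
    proof
      assume int: "s k - u \<in> int_lattice"
      have tk: "set (take k ys) \<subseteq> T" "ys = [] @ take k ys @ drop k ys" "length (take k ys) = k"
        using setys that by (auto simp: K_def dest: in_set_takeD)
      have nat: "s k - u \<in> nat_lattice"
        using promote[OF tk(1) that(3)] int by (simp add: s_def)
      have "\<exists>zs. set zs \<subseteq> T \<and> sum_list zs = u \<and> length zs \<le> 1"
      proof (cases "u = 0")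
        case True
        then show ?thesis by (intro exI[of _ "[]"]) auto
      next
        case False
        then show ?thesis using that(3) by (intro exI[of _ "[u]"]) auto
      qed
      then obtain zs where "set zs \<subseteq> T" "sum_list zs = u" "length zs \<le> 1" by blast
      with block[OF tk(2), of zs] nat tk(3) that(1) show False by (simp add: s_def)
    qed
    have small: "u = u'" if "u \<in> insert 0 T" "u' \<in> insert 0 T" "u - u' \<in> int_lattice" for u u'
      using that T(2) by (intro half_open_cube_congruent_eq) (auto simp: fractional_def half_open_cube_def)
    define Y where "Y = insert 0 T \<union> s ` {2..K}"
    have "incongruent Y"
      unfolding incongruent_def
    proof (intro ballI impI)
      fix x y assume "x \<in> Y" "y \<in> Y" and int: "x - y \<in> int_lattice"
      then have int': "y - x \<in> int_lattice" using int_lattice_minus_commute by blast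
      consider "x \<in> insert 0 T" "y \<in> insert 0 T"
        | k where "2 \<le> k" "k \<le> K" "x = s k" "y \<in> insert 0 T"
        | k where "2 \<le> k" "k \<le> K" "y = s k" "x \<in> insert 0 T"
        | k l where "k \<le> K" "x = s k" "l \<le> K" "y = s l"
        using \<open>x \<in> Y\<close> \<open>y \<in> Y\<close> unfolding Y_def by auto
      then show "x = y"
      proof cases
        case 1 then show ?thesis using small int by blast
      next
        case 2 then show ?thesis using early int by blast
      next
        case 3 then show ?thesis using early int' by blast
      next
        case (4 k l)
        then show ?thesis using later[of k l] later[of l k] int int' by (cases k l rule: linorder_cases) auto
      qed
    qed
    moreover have "finite Y" using T(1) by (simp add: Y_def)
    moreover have "Y \<subseteq> \<Gamma>"
    proof -
      have "sum_list zs \<in> \<Gamma>" if "set zs \<subseteq> T" for zs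
        using that T(3) \<Gamma> by (induction zs) auto
      then have "s k \<in> \<Gamma>" for k
        using setys by (auto simp: s_def dest: in_set_takeD)
      then show ?thesis using T(3) \<Gamma>(1) by (auto simp: Y_def)
    qed
    ultimately have "real (card Y) \<le> m" by (intro m)
    moreover have "card Y = K + card T"
    proof -
      have "inj_on s {2..K}"
      proof (rule inj_onI)
        fix k l assume kl: "k \<in> {2..K}" "l \<in> {2..K}" "s k = s l"
        then have "s k - s l \<in> int_lattice" "s l - s k \<in> int_lattice" by (auto simp: int_lattice_def)
        then show "k = l" using later[of k l] later[of l k] kl by (cases k l rule: linorder_cases) auto
      qed
      then have "card (s ` {2..K}) = K - 1" by (simp add: card_image)
      moreover have "insert 0 T \<inter> s ` {2..K} = {}"
      proof -
        have "s k \<notin> insert 0 T" if "2 \<le> k" "k \<le> K" for k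
          using early[OF that, of "s k"] by (auto simp: int_lattice_def)
        then show ?thesis by auto
      qed
      moreover have "0 \<notin> T" using T(2) by (auto simp: fractional_def)
      ultimately show ?thesis
        using T(1) K by (simp add: Y_def card_Un_disjoint del: Un_insert_left)
    qed
    ultimately show ?thesis
      using ys by (intro that[of ys]) (auto simp: P_def K_def)
  qed
qed

section \<open>Membership in the semigroup of a simplex\<close>

lemma sum_list_replicate_scaleR: "sum_list (replicate n t) = of_nat n *\<^sub>R (t :: 'a::real_vector)"
  by (induction n) (auto simp: scaleR_left.add)

text \<open>The semigroup generated by \<open>T\<close> and the unit vectors.\<close>

definition generated_semigroup :: "(real ^ 'k) set \<Rightarrow> (real ^ 'k) set" where
  "generated_semigroup T = {sum_list xs + q | xs q. set xs \<subseteq> T \<and> q \<in> nat_lattice}"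

text \<open>Only the coordinate \<open>i\<close> can have become negative, and it is an integer.\<close>

lemma not_nat_after_subtracting_axis:
  assumes "q \<in> nat_lattice" "q - of_nat j *\<^sub>R axis i 1 \<notin> nat_lattice"
  shows "q $ i - of_nat j \<le> -1"
proof (rule ccontr)
  assume "\<not> ?thesis"
  then have "q $ i - of_nat j > -1" by simp
  moreover have "q $ l \<ge> 0" for l
    using assms(1) unfolding nat_lattice_def by (metis Nats_cases mem_Collect_eq of_nat_0_le_iff)
  then have ll: "q $ l > -1" for l by (meson less_le_trans neg_less_0_iff_less zero_less_one)
  moreover have "q $ l \<in> \<int>" for l
    using assms(1) by (auto simp: nat_lattice_iff int_lattice_def)
  ultimately have "q - of_nat j *\<^sub>R axis i 1 \<in> nat_lattice"
    unfolding nat_lattice_iff int_lattice_def by (auto simp: axis_def)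
  with assms(2) show False by simp
qed

text \<open>The hypothesis \<open>ex\<close> says that for every \<open>i\<close> the vector \<open>w\<close> can be written with the given
  generators if the unit vector \<open>axis i 1\<close> may be used a negative number of times.  Shorten the part
  of such an expression that comes from \<open>T\<close>.  If \<open>w\<close> is not in the semigroup, the coefficient of
  \<open>axis i 1\<close> is at most \<open>-1\<close>, so \<open>w $ i\<close> is at most the \<open>i\<close>-th coordinate of the part from \<open>T\<close> minus
  1, which is smaller than its length minus 1.  With all coordinates of \<open>w\<close> bounded in this way,
  their sum is too small.\<close>

lemma in_generated_semigroup_if_high:
  fixes T \<Gamma> :: "(real ^ 'k) set" and m :: real
  assumes T: "finite T" "fractional T" "T \<subseteq> \<Gamma>"
    and \<Gamma>: "0 \<in> \<Gamma>" "\<And>x y. x \<in> \<Gamma> \<Longrightarrow> y \<in> \<Gamma> \<Longrightarrow> x + y \<in> \<Gamma>"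
    and m: "\<And>Y. finite Y \<Longrightarrow> Y \<subseteq> \<Gamma> \<Longrightarrow> incongruent Y \<Longrightarrow> real (card Y) \<le> m"
    and nonneg: "\<And>i. 0 \<le> w $ i"
    and high: "(\<Sum>i\<in>UNIV. w $ i) \<ge> real CARD('k) * (m - real (card T) - 1)"
    and ex: "\<And>i. \<exists>j. w + of_nat j *\<^sub>R axis i 1 \<in> generated_semigroup T"
  shows "w \<in> generated_semigroup T"
proof (rule ccontr)
  assume notin: "w \<notin> generated_semigroup T"
  have "w $ i < m - real (card T) - 1" for i
  proof -
    obtain j xs q where xs: "set xs \<subseteq> T" and q: "q \<in> nat_lattice"
      and eq: "w + of_nat j *\<^sub>R axis i 1 = sum_list xs + q"
      using ex[of i] by (auto simp: generated_semigroup_def)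
    obtain ys where ys: "set ys \<subseteq> T" "sum_list xs - sum_list ys \<in> nat_lattice"
      and len: "real (length ys) + real (card T) \<le> m \<or> ys = []"
      by (rule shorten_sequence[OF T \<Gamma> m xs])
    define r where "r = sum_list xs - sum_list ys + q"
    have r: "r \<in> nat_lattice" using nat_lattice_add[OF ys(2) q] by (simp add: r_def)
    have w: "w = sum_list ys + (r - of_nat j *\<^sub>R axis i 1)"
      using eq by (simp add: r_def algebra_simps)
    with notin ys(1) have "r - of_nat j *\<^sub>R axis i 1 \<notin> nat_lattice"
      by (auto simp: generated_semigroup_def)
    from not_nat_after_subtracting_axis[OF r this] have neg: "r $ i - of_nat j \<le> -1" .
    have wi: "w $ i = sum_list ys $ i + (r $ i - of_nat j)"
      by (subst w) (simp add: axis_def)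
    have "ys \<noteq> []" using nonneg[of i] neg wi by auto
    then show ?thesis
      using sum_list_fractional_less[OF T(2) ys(1), of i] len neg wi by auto
  qed
  then have "(\<Sum>i\<in>UNIV. w $ i) < (\<Sum>i\<in>(UNIV :: 'k set). m - real (card T) - 1)"
    by (intro sum_strict_mono) auto
  with high show False by simp
qed

text \<open>For every \<open>i\<close> there is an expression of \<open>w\<close> as \<open>n i\<close> copies of \<open>t\<close> plus an integer vector which
  is nonnegative outside the coordinate \<open>i\<close>.  For two coordinates \<open>i \<noteq> l\<close>, the expression
  with fewer copies, say that for \<open>i\<close>, is nonnegative in the coordinate \<open>i\<close> as well: there it subtracts no more from \<open>w $ i\<close> than the
  expression for \<open>l\<close> does, and the latter leaves something nonnegative.\<close>

lemma in_generated_semigroup_if_one_generator: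
  fixes T :: "(real ^ 'k) set"
  assumes frac: "fractional T" and T: "T \<subseteq> {t}" and k: "CARD('k) \<ge> 2"
    and ex: "\<And>i. \<exists>j. w + of_nat j *\<^sub>R axis i 1 \<in> generated_semigroup T"
  shows "w \<in> generated_semigroup T"
proof -
  have "\<exists>n j q. w + of_nat j *\<^sub>R axis i 1 = of_nat n *\<^sub>R t + q \<and> q \<in> nat_lattice \<and> (n = 0 \<or> t \<in> T)" for i
  proof -
    obtain j xs q where xs: "set xs \<subseteq> T" and q: "q \<in> nat_lattice"
      and eq: "w + of_nat j *\<^sub>R axis i 1 = sum_list xs + q"
      using ex[of i] by (auto simp: generated_semigroup_def)
    have "xs = replicate (length xs) t" 
      using xs T by (intro replicate_eqI) auto
    then have "sum_list xs = of_nat (length xs) *\<^sub>R t" using sum_list_replicate_scaleR by metis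
    then have "w + of_nat j *\<^sub>R axis i 1 = of_nat (length xs) *\<^sub>R t + q" using eq by simp
    moreover have "length xs = 0 \<or> t \<in> T" using xs T by (cases xs) auto
    ultimately show ?thesis using q by blast
  qed
  then obtain n j q where eq: "\<And>i. w + of_nat (j i) *\<^sub>R axis i 1 = of_nat (n i) *\<^sub>R t + q i"
    and q: "\<And>i. q i \<in> nat_lattice" and nT: "\<And>i. n i = 0 \<or> t \<in> T" by metis
  have *: "w \<in> generated_semigroup T" if "n i \<le> n l" "i \<noteq> l" for i l
  proof -
    define r where "r = q i - of_nat (j i) *\<^sub>R axis i 1"
    have w: "w = of_nat (n i) *\<^sub>R t + r" using eq[of i] by (simp add: r_def algebra_simps)
    have "of_nat (n i) * t $ i \<le> of_nat (n l) * t $ i"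
      using that(1) nT[of l] frac by (cases "n l = 0") (auto simp: fractional_def intro!: mult_right_mono)
    moreover have "w $ i = of_nat (n l) * t $ i + q l $ i"
      using arg_cong[OF eq[of l], of "\<lambda>v. v $ i"] that(2) by (simp add: axis_def)
    moreover have "q l $ i > -1" using q[of l] by (simp add: nat_lattice_iff)
    ultimately have "r $ i > -1" using arg_cong[OF w, of "\<lambda>v. v $ i"] by simp
    then have "q i $ i - of_nat (j i) > -1" by (simp add: r_def axis_def)
    then have r: "r \<in> nat_lattice"
      using not_nat_after_subtracting_axis[OF q[of i], of "j i" i] by (fastforce simp: r_def)
    have "w = sum_list (replicate (n i) t) + r"
      by (subst w) (simp add: sum_list_replicate_scaleR)
    moreover have "set (replicate (n i) t) \<subseteq> T" using nT[of i] by auto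
    ultimately show ?thesis using r unfolding generated_semigroup_def by blast
  qed
  obtain i l :: 'k where "i \<noteq> l"
    using k card_le_Suc0_iff_eq[of "UNIV :: 'k set"] by auto
  then show ?thesis using *[of i l] *[of l i] by (cases "n i \<le> n l") auto
qed

lemma sum_UNIV_option: "(\<Sum>i\<in>(UNIV :: 'n::finite option set). f i) = f None + (\<Sum>j\<in>UNIV. f (Some j))"
  by (simp add: UNIV_option_conv sum.reindex)

section \<open>Sumsets and exceptional sets\<close>

lemma zero_in_sumset: "0 \<in> sumset 0 A"
  by (simp add: sumset_def)

lemma sumset_Suc: "x \<in> sumset (Suc N) A \<longleftrightarrow> (\<exists>y\<in>sumset N A. \<exists>a\<in>A. x = y + a)"
proof
  assume "x \<in> sumset (Suc N) A"
  then obtain f where f: "x = (\<Sum>i<Suc N. f i)" "\<forall>i<Suc N. f i \<in> A" by (auto simp: sumset_def)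
  then show "\<exists>y\<in>sumset N A. \<exists>a\<in>A. x = y + a"
    by (intro bexI[of _ "\<Sum>i<N. f i"] bexI[of _ "f N"]) (auto simp: sumset_def)
next
  assume "\<exists>y\<in>sumset N A. \<exists>a\<in>A. x = y + a"
  then obtain f a where f: "\<forall>i<N. f i \<in> A" "a \<in> A" "x = (\<Sum>i<N. f i) + a" by (auto simp: sumset_def)
  have "(\<Sum>i<Suc N. (f(N := a)) i) = x" using f(3) by simp
  then show "x \<in> sumset (Suc N) A"
    using f(1,2) by (auto simp: sumset_def less_Suc_eq intro!: exI[of _ "f(N := a)"])
qed

lemma sumset_add: "x \<in> sumset N A \<Longrightarrow> y \<in> sumset M A \<Longrightarrow> x + y \<in> sumset (N + M) A"
proof (induction M arbitrary: y)
  case 0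
  then show ?case by (simp add: sumset_def)
next
  case (Suc M)
  then obtain z a where "z \<in> sumset M A" "a \<in> A" "y = z + a" by (auto simp: sumset_Suc)
  then have "x + z \<in> sumset (N + M) A" "x + y = (x + z) + a"
    using Suc.IH[of z] Suc.prems(1) by (auto simp: add.assoc)
  then show ?case using \<open>a \<in> A\<close> by (auto simp only: add_Suc_right sumset_Suc)
qed

lemma sumset_multiple:
  fixes a :: "'a::real_vector"
  shows "a \<in> A \<Longrightarrow> of_nat n *\<^sub>R a \<in> sumset n A"
proof (induction n)
  case (Suc n)
  have "of_nat (Suc n) *\<^sub>R a = of_nat n *\<^sub>R a + a" by (simp add: scaleR_left.add)
  then show ?case unfolding sumset_Suc using Suc by blast
qed (simp add: zero_in_sumset)

text \<open>Membership in \<open>all_sumsets (a - A)\<close> thus means that \<open>real n *\<^sub>R a - e\<close> becomes a sum of elements of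
  \<open>A\<close> for some \<open>n\<close>; this links exceptional sets to the semigroup generated by \<open>A\<close>.\<close>

lemma sumset_reflect:
  fixes a :: "'a::real_vector"
  shows "e \<in> sumset n ((\<lambda>a'. a - a') ` A) \<longleftrightarrow> of_nat n *\<^sub>R a - e \<in> sumset n A"
proof (induction n arbitrary: e)
  case (Suc n)
  have "e \<in> sumset (Suc n) ((\<lambda>a'. a - a') ` A) \<longleftrightarrow> (\<exists>b\<in>A. e - (a - b) \<in> sumset n ((\<lambda>a'. a - a') ` A))"
    by (force simp: sumset_Suc)
  also have "\<dots> \<longleftrightarrow> (\<exists>b\<in>A. of_nat (Suc n) *\<^sub>R a - e - b \<in> sumset n A)"
    by (simp add: Suc.IH scaleR_left.add algebra_simps)
  also have "\<dots> \<longleftrightarrow> of_nat (Suc n) *\<^sub>R a - e \<in> sumset (Suc n) A"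
    by (force simp: sumset_Suc)
  finally show ?case .
qed (auto simp: sumset_def)

lemma group_closure_scaleR:
  fixes s :: "'a::real_vector"
  shows "s \<in> group_closure S \<Longrightarrow> of_nat n *\<^sub>R s \<in> group_closure S"
  by (induction n) (auto simp: scaleR_left.add intro: group_closure_add)

lemma group_closure_subgroup:
  assumes "S \<subseteq> group_closure S'" "x \<in> group_closure S"
  shows "x \<in> group_closure S'"
  using assms(2) by induction (use assms(1) in \<open>auto intro: group_closure.diff\<close>)

text \<open>If \<open>x\<close> is a sum of \<open>N\<close> elements of \<open>A\<close>, then
  \<open>real N *\<^sub>R a - x\<close> is a sum of \<open>N\<close> elements of \<open>a - A\<close> and so not exceptional.\<close>

lemma sumset_subset_structure:
  fixes A :: "(real ^ 'n) set"
  assumes "a\<^sub>0 \<in> A" "N \<ge> 1" "x \<in> sumset N A"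
  shows "x \<in> ((\<lambda>x. real N *\<^sub>R x) ` (convex hull A) \<inter>
        (\<lambda>x. real N *\<^sub>R a\<^sub>0 + x) ` group_closure (diff_set A)) -
       (\<Union>a \<in> hull_extremal_points A.
          (\<lambda>e. real N *\<^sub>R a - e) ` exceptional_set ((\<lambda>a'. a - a') ` A))"
proof -
  obtain f where f: "x = (\<Sum>i<N. f i)" "\<And>i. i < N \<Longrightarrow> f i \<in> A"
    using assms(3) by (auto simp: sumset_def)
  have "(\<Sum>i<N. (1 / real N) *\<^sub>R f i) \<in> convex hull A"
    using assms(2) f(2) by (intro convex_sum) (auto simp: hull_inc)
  moreover have "x = real N *\<^sub>R (\<Sum>i<N. (1 / real N) *\<^sub>R f i)"
    using assms(2) by (simp add: f(1) scaleR_sum_right)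
  moreover have "x - real N *\<^sub>R a\<^sub>0 \<in> group_closure (diff_set A)"
  proof -
    have "y - real n *\<^sub>R a\<^sub>0 \<in> group_closure (diff_set A)" if "y \<in> sumset n A" for n y
      using that
    proof (induction n arbitrary: y)
      case (Suc n)
      then obtain z a where z: "z \<in> sumset n A" "a \<in> A" "y = z + a" by (auto simp: sumset_Suc)
      then have "a - a\<^sub>0 \<in> group_closure (diff_set A)"
        using assms(1) by (auto simp: diff_set_def intro!: group_closure.base)
      from group_closure_add[OF Suc.IH[OF z(1)] this] show ?case
        by (simp add: z(3) scaleR_left.add algebra_simps)
    qed (auto simp: sumset_def)
    then show ?thesis using assms(3) by blast
  qed
  moreover have "e \<in> all_sumsets ((\<lambda>a'. a - a') ` A)" if "x = real N *\<^sub>R a - e" for a e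
    using that assms(2,3) sumset_reflect[of e N a A] by (auto simp: all_sumsets_def)
  ultimately show ?thesis
    by (force simp: exceptional_set_def image_iff intro: bexI[of _ "x - real N *\<^sub>R a\<^sub>0"])
qed

section \<open>Barycentric coordinates over a lattice simplex\<close>

text \<open>The vertices are indexed by \<open>'n option\<close>, so that \<open>\<beta> None\<close> can serve as the origin and the
  remaining vertices match the coordinates of the ambient space.\<close>

locale lattice_simplex =
  fixes A :: "(real ^ 'n) set" and \<beta> :: "'n option \<Rightarrow> real ^ 'n"
  assumes finite_A: "finite A" and A_int: "A \<subseteq> int_lattice"
    and inj_\<beta>: "inj \<beta>" and \<beta>_A: "range \<beta> \<subseteq> A"
    and span_\<beta>: "span (diff_set (range \<beta>)) = UNIV"
    and hull_eq: "convex hull A = convex hull (range \<beta>)"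
begin

definition edge_map :: "real ^ 'n \<Rightarrow> real ^ 'n" where
  "edge_map y = (\<Sum>j\<in>UNIV. y $ j *\<^sub>R (\<beta> (Some j) - \<beta> None))"

text \<open>A vector \<open>c\<close> is read as the formal combination \<open>\<Sum>i. c $ i * \<beta> i\<close> of the vertices.  Its value
  \<open>point c\<close> and its total weight \<open>height c\<close> are the two components of the corresponding point of the
  cone over the simplex; sums of \<open>N\<close> elements of \<open>A\<close> live at height \<open>N\<close>.\<close>

definition point :: "real ^ 'n option \<Rightarrow> real ^ 'n" where
  "point c = (\<Sum>i\<in>UNIV. c $ i *\<^sub>R \<beta> i)"

definition height :: "real ^ 'n option \<Rightarrow> real" where
  "height c = (\<Sum>i\<in>UNIV. c $ i)"

lemma linear_edge_map: "linear edge_map"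
  unfolding edge_map_def by (rule linearI) (simp_all add: scaleR_left.add sum.distrib scaleR_sum_right)

lemma inj_edge_map: "inj edge_map"
proof -
  have edge: "\<beta> i - \<beta> None \<in> range edge_map" for i
  proof (cases i)
    case None
    then show ?thesis using linear_0[OF linear_edge_map] by (metis diff_self rangeI)
  next
    case (Some j)
    have "edge_map (axis j 1) = \<beta> i - \<beta> None"
      unfolding edge_map_def Some by (subst sum.remove[of _ j]) (auto simp: axis_def)
    then show ?thesis by (metis rangeI)
  qed
  have sub: "subspace (range edge_map)" using linear_edge_map by (simp add: linear_subspace_image)
  have "diff_set (range \<beta>) \<subseteq> range edge_map"
  proof
    fix x assume "x \<in> diff_set (range \<beta>)"
    then obtain i l where "x = (\<beta> i - \<beta> None) - (\<beta> l - \<beta> None)" by (auto simp: diff_set_def)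
    then show "x \<in> range edge_map" using subspace_diff[OF sub edge edge] by metis
  qed
  then have "surj edge_map" using span_minimal[OF _ sub] span_\<beta> by blast
  then show ?thesis using linear_edge_map by (simp add: linear_surjective_imp_injective)
qed

lemma edge_map_int_lattice: "edge_map ` int_lattice \<subseteq> int_lattice"
proof -
  have "\<beta> i \<in> int_lattice" for i using \<beta>_A A_int by blast
  then show ?thesis by (auto simp: edge_map_def int_lattice_def intro!: Ints_sum Ints_mult Ints_diff)
qed

lemma point_edge_map: "point c = height c *\<^sub>R \<beta> None + edge_map (\<chi> j. c $ Some j)"
  by (simp add: point_def height_def edge_map_def sum_UNIV_option scaleR_sum_left sum.distrib[symmetric]
      algebra_simps)

lemma linear_point: "linear point"
  unfolding point_def by (rule linearI) (simp_all add: scaleR_left.add sum.distrib scaleR_sum_right)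

lemma linear_height: "linear height"
  unfolding height_def by (rule linearI) (simp_all add: sum.distrib sum_distrib_left)

lemma point_height_eqI:
  assumes "point c = point c'" "height c = height c'"
  shows "c = c'"
proof -
  have "edge_map (\<chi> j. c $ Some j) = edge_map (\<chi> j. c' $ Some j)"
    using assms by (simp add: point_edge_map)
  then have "(\<chi> j. c $ Some j) = (\<chi> j. c' $ Some j)" by (rule injD[OF inj_edge_map])
  then have *: "c $ Some j = c' $ Some j" for j by (simp add: vec_eq_iff)
  with assms(2) have "c $ None = c' $ None" by (simp add: height_def sum_UNIV_option)
  with * have "c $ i = c' $ i" for i by (cases i) auto
  then show ?thesis by (simp add: vec_eq_iff)
qed

lemma ex_point_height: "\<exists>c. point c = x \<and> height c = N"
proof -
  have "surj edge_map" using inj_edge_map linear_edge_map by (simp add: linear_injective_imp_surjective)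
  then obtain y where y: "edge_map y = x - N *\<^sub>R \<beta> None" by (metis surjD)
  define c :: "real ^ 'n option" where
    "c = (\<chi> i. case i of None \<Rightarrow> N - (\<Sum>j\<in>UNIV. y $ j) | Some j \<Rightarrow> y $ j)"
  have "height c = N" by (simp add: height_def c_def sum_UNIV_option)
  moreover have "(\<chi> j. c $ Some j) = y" by (simp add: c_def vec_eq_iff)
  ultimately show ?thesis using y by (intro exI[of _ c]) (simp add: point_edge_map)
qed

text \<open>For \<open>N = 1\<close> these are the usual barycentric coordinates of \<open>x\<close>; for \<open>N = 0\<close> they are the linear
  parts of those affine functions.\<close>

definition bary :: "real ^ 'n \<Rightarrow> real \<Rightarrow> real ^ 'n option" where
  "bary x N = (THE c. point c = x \<and> height c = N)"

lemma point_bary [simp]: "point (bary x N) = x" and height_bary [simp]: "height (bary x N) = N"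
proof -
  have "\<exists>!c. point c = x \<and> height c = N" using ex_point_height point_height_eqI by metis
  from theI'[OF this] show "point (bary x N) = x" "height (bary x N) = N" by (auto simp: bary_def)
qed

lemma baryI: "point c = x \<Longrightarrow> height c = N \<Longrightarrow> bary x N = c"
  by (rule point_height_eqI) auto

lemma bary_add: "bary (x + y) (N + M) = bary x N + bary y M"
  by (rule baryI) (simp_all add: linear_add[OF linear_point] linear_add[OF linear_height])

lemma bary_scaleR: "bary (r *\<^sub>R x) (r * N) = r *\<^sub>R bary x N"
  by (rule baryI) (simp_all add: linear_scale[OF linear_point] linear_scale[OF linear_height])

lemma bary_vertex: "bary (\<beta> i) 1 = axis i 1"
proof (rule baryI)
  show "point (axis i 1) = \<beta> i" unfolding point_def by (subst sum.remove[of _ i]) (auto simp: axis_def)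
  show "height (axis i 1) = 1" unfolding height_def by (subst sum.remove[of _ i]) (auto simp: axis_def)
qed

lemma bary_hull_nonneg:
  assumes "x \<in> convex hull A"
  shows "0 \<le> bary x 1 $ i"
proof -
  obtain u where u: "\<forall>b\<in>range \<beta>. 0 \<le> u b" "sum u (range \<beta>) = 1" "(\<Sum>b\<in>range \<beta>. u b *\<^sub>R b) = x"
    using assms unfolding hull_eq by (auto simp: convex_hull_finite)
  have "bary x 1 = (\<chi> i. u (\<beta> i))"
    using u(2,3) inj_\<beta> by (intro baryI) (simp_all add: point_def height_def sum.reindex)
  then show ?thesis using u(1) by simp
qed

lemma bary_hull_less_1:
  assumes "x \<in> convex hull A" "x \<noteq> \<beta> i"
  shows "bary x 1 $ i < 1"
proof (rule ccontr)
  assume "\<not> ?thesis"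
  then have ge: "bary x 1 $ i \<ge> 1" by simp
  have sum: "bary x 1 $ i + (\<Sum>l\<in>UNIV - {i}. bary x 1 $ l) = 1"
    using height_bary[of x 1] unfolding height_def by (subst (asm) sum.remove[of _ i]) auto
  have nn: "0 \<le> (\<Sum>l\<in>UNIV - {i}. bary x 1 $ l)"
    using bary_hull_nonneg[OF assms(1)] by (intro sum_nonneg) auto
  with ge sum have "bary x 1 $ i = 1" "(\<Sum>l\<in>UNIV - {i}. bary x 1 $ l) = 0" by linarith+
  moreover from this(2) have "bary x 1 $ l = 0" if "l \<noteq> i" for l
    using that bary_hull_nonneg[OF assms(1)] by (subst (asm) sum_nonneg_eq_0_iff) auto
  ultimately have "bary x 1 = axis i 1" by (auto simp: vec_eq_iff axis_def)
  also have "\<dots> = bary (\<beta> i) 1" by (simp add: bary_vertex)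
  finally show False using assms(2) by (metis point_bary)
qed

text \<open>The barycentric coordinate belonging to a vertex is an affine function which is largest exactly at
  that vertex; minus its linear part exposes the vertex.\<close>

lemma vertex_extremal: "\<beta> i \<in> hull_extremal_points A"
proof -
  define L where "L x = bary x 0 $ i" for x
  have "linear L"
    unfolding L_def
  proof (rule linearI)
    show "bary (x + y) 0 $ i = bary x 0 $ i + bary y 0 $ i" for x y
      using bary_add[of x y 0 0] by simp
    show "bary (r *\<^sub>R x) 0 $ i = r *\<^sub>R bary x 0 $ i" for r x
      using bary_scaleR[of r x 0] by simp
  qed
  have L: "bary x 1 $ i = L x + bary 0 1 $ i" for x
    using bary_add[of x 0 0 1] by (simp add: L_def)
  define v where "v = - adjoint L 1"
  have v: "v \<bullet> x = - L x" for x
    using adjoint_works[OF \<open>linear L\<close>, of x 1] by (simp add: v_def inner_commute)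
  have vhull: "\<beta> l \<in> convex hull A" for l using \<beta>_A by (intro hull_inc) auto
  have expose: "v \<bullet> x > v \<bullet> \<beta> i" if "x \<in> convex hull A - {\<beta> i}" for x
    using bary_hull_less_1[of x i] that L[of x] L[of "\<beta> i"] by (simp add: v bary_vertex)
  \<comment> \<open>A second vertex shows that the exposing direction is not zero.\<close>
  obtain l where "l \<noteq> i" by (metis option.distinct(1))
  then have "\<beta> l \<in> convex hull A - {\<beta> i}" using vhull inj_\<beta> by (auto dest: injD)
  from expose[OF this] have "v \<noteq> 0" by auto
  moreover have "span (diff_set A) = UNIV"
    using span_mono[of "diff_set (range \<beta>)" "diff_set A"] span_\<beta> \<beta>_A unfolding diff_set_def by blast
  ultimately show ?thesis
    using expose vhull[of i] unfolding hull_extremal_points_def by blast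
qed

text \<open>With the vertex \<open>\<beta> None\<close> moved to the origin, the simplex is the image of the standard simplex under
  \<open>edge_map\<close>, and the image of the unit cube is a fundamental parallelepiped of the lattice spanned by
  the edges.\<close>

lemma hull_volume: "emeasure lborel (edge_map ` half_open_cube) =
    ennreal (fact CARD('n) * measure lebesgue (convex hull A))"
proof -
  let ?D = "convex hull (insert 0 Basis) :: (real ^ 'n) set"
  have im: "insert 0 ((\<lambda>j. \<beta> (Some j) - \<beta> None) ` UNIV) = edge_map ` insert 0 Basis"
  proof -
    have "edge_map (axis j 1) = \<beta> (Some j) - \<beta> None" for j
      unfolding edge_map_def by (subst sum.remove[of _ j]) (auto simp: axis_def)
    then show ?thesis
      by (force simp: Basis_vec_def linear_0[OF linear_edge_map] image_iff)
  qed
  have "range \<beta> = (\<lambda>x. \<beta> None + x) ` edge_map ` insert 0 Basis"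
    unfolding im[symmetric] by (simp add: UNIV_option_conv image_image)
  then have hull: "convex hull A = (\<lambda>x. \<beta> None + x) ` (edge_map ` ?D)"
    unfolding hull_eq by (simp only: convex_hull_translation convex_hull_linear_image[OF linear_edge_map])
  have "compact (edge_map ` ?D)"
    using linear_edge_map
    by (intro compact_continuous_image finite_imp_compact_convex_hull linear_continuous_on)
      (auto simp: linear_conv_bounded_linear)
  then have fin: "emeasure lborel (edge_map ` ?D) < \<infinity>" and borel: "edge_map ` ?D \<in> sets borel"
    using emeasure_bounded_finite compact_imp_bounded borel_compact by blast+
  have "measure lebesgue (convex hull A) = measure lebesgue (edge_map ` ?D)"
    unfolding hull by (rule measure_translation)
  also have "\<dots> = measure lborel (edge_map ` ?D)" using borel by (simp add: measure_completion)
  finally have "emeasure lborel (edge_map ` ?D) = ennreal (measure lebesgue (convex hull A))"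
    using fin by (simp add: emeasure_eq_ennreal_measure)
  then show ?thesis
    unfolding emeasure_linear_image_std_simplex[OF linear_edge_map inj_edge_map]
    by (simp add: ennreal_mult ennreal_fact)
qed

definition integral_points :: "(real ^ 'n option) set" where
  "integral_points = {c. point c \<in> int_lattice \<and> height c \<in> \<int>}"

text \<open>As heights are integers, subtracting \<open>height c\<close> times the unit vector of \<open>None\<close> keeps the class
  of \<open>c\<close> modulo the integer vectors and moves \<open>c\<close> to height 0, where congruence of coordinates is
  congruence of points modulo the lattice spanned by the edges; so the volume bound for that lattice applies.\<close>

lemma card_incongruent_le_volume:
  assumes "finite Y" "Y \<subseteq> integral_points" "incongruent Y"
  shows "real (card Y) \<le> fact CARD('n) * measure lebesgue (convex hull A)"
proof -
  define p where "p c = point c - height c *\<^sub>R \<beta> None" for c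
  have inc: "c = c'" if "c \<in> Y" "c' \<in> Y" "p c - p c' \<in> edge_map ` int_lattice" for c c'
  proof -
    define d where "d = c - c'"
    have "p c - p c' = p d"
      by (simp add: p_def d_def linear_diff[OF linear_point] linear_diff[OF linear_height] algebra_simps)
    also have "\<dots> = edge_map (\<chi> j. d $ Some j)" by (simp add: p_def point_edge_map)
    finally have "(\<chi> j. d $ Some j) \<in> int_lattice"
      using that(3) inj_edge_map by (auto dest: injD)
    then have j: "d $ Some j \<in> \<int>" for j by (simp add: int_lattice_def)
    have "height d \<in> \<int>"
      using assms(2) that(1,2) by (auto simp: d_def integral_points_def linear_diff[OF linear_height]
          intro!: Ints_diff)
    moreover have "d $ None = height d - (\<Sum>j\<in>UNIV. d $ Some j)"
      by (simp add: height_def sum_UNIV_option)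
    ultimately have "d $ None \<in> \<int>" using j by (auto intro!: Ints_diff Ints_sum)
    with j have "d $ i \<in> \<int>" for i by (cases i) auto
    then have "c - c' \<in> int_lattice" by (simp add: d_def int_lattice_def)
    then show ?thesis using assms(3) that(1,2) by (auto simp: incongruent_def)
  qed
  have "0 \<in> edge_map ` int_lattice"
    using linear_0[OF linear_edge_map] by (auto simp: int_lattice_def intro!: image_eqI[of _ _ 0])
  then have "inj_on p Y" using inc by (intro inj_onI) auto
  then have "of_nat (card Y) = (of_nat (card (p ` Y)) :: ennreal)" by (simp add: card_image)
  also have "\<dots> \<le> emeasure lborel (edge_map ` half_open_cube)"
  proof (rule card_incongruent_le[OF linear_edge_map inj_edge_map edge_map_int_lattice])
    have "\<beta> None \<in> int_lattice" using \<beta>_A A_int by blast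
    then show "p ` Y \<subseteq> int_lattice" using assms(2) by (auto simp: p_def integral_points_def int_lattice_def)
  qed (use assms(1) inc in auto)
  finally show ?thesis
    unfolding hull_volume by (simp add: ennreal_of_nat_eq_real_of_nat)
qed

definition inner_coords :: "(real ^ 'n option) set" where
  "inner_coords = (\<lambda>a. bary a 1) ` (A - range \<beta>)"

lemma finite_inner_coords: "finite inner_coords" using finite_A by (simp add: inner_coords_def)

lemma card_inner_coords: "card inner_coords + CARD('n) + 1 = card A"
proof -
  have "inj_on (\<lambda>a. bary a 1) (A - range \<beta>)" by (metis inj_onI point_bary)
  then have "card inner_coords = card A - card (range \<beta>)"
    using \<beta>_A by (simp add: inner_coords_def card_image card_Diff_subset)
  moreover have "card (range \<beta>) = CARD('n) + 1" using inj_\<beta> by (simp add: card_image)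
  moreover have "card (range \<beta>) \<le> card A" using \<beta>_A finite_A by (rule card_mono[rotated])
  ultimately show ?thesis by simp
qed

lemma fractional_inner_coords: "fractional inner_coords"
proof -
  have "bary a 1 \<noteq> 0" for a
    using height_bary[of a 1] linear_0[OF linear_height] by (metis zero_neq_one)
  moreover have "0 \<le> bary a 1 $ i \<and> bary a 1 $ i < 1" if "a \<in> A - range \<beta>" for a i
    using that bary_hull_nonneg[of a i] bary_hull_less_1[of a i] hull_inc[of a A] by auto
  ultimately show ?thesis by (auto simp: fractional_def inner_coords_def)
qed

lemma inner_coords_subset_integral_points: "inner_coords \<subseteq> integral_points"
  using A_int by (auto simp: inner_coords_def integral_points_def)

lemma zero_in_integral_points: "0 \<in> integral_points"
  by (simp add: integral_points_def linear_0[OF linear_point] linear_0[OF linear_height] int_lattice_def)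

lemma integral_points_add: "x \<in> integral_points \<Longrightarrow> y \<in> integral_points \<Longrightarrow> x + y \<in> integral_points"
  by (simp add: integral_points_def linear_add[OF linear_point] linear_add[OF linear_height] int_lattice_def)

text \<open>The vertices have the unit vectors as coordinates, and the height counts the summands, so
  membership in a sumset is membership in the semigroup generated by all coordinate vectors.\<close>

lemma sumset_iff_semigroup: "x \<in> sumset N A \<longleftrightarrow> bary x (real N) \<in> generated_semigroup inner_coords"
proof
  assume "x \<in> sumset N A"
  then show "bary x (real N) \<in> generated_semigroup inner_coords"
  proof (induction N arbitrary: x)
    case 0
    have "bary 0 0 = 0" by (rule baryI) (simp_all add: linear_0[OF linear_point] linear_0[OF linear_height])
    then show ?case using 0
      by (auto simp: sumset_def generated_semigroup_def intro!: exI[of _ "[]"] zero_in_nat_lattice)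
  next
    case (Suc N)
    then obtain y a where y: "y \<in> sumset N A" "a \<in> A" "x = y + a" by (auto simp: sumset_Suc)
    then obtain xs q where xs: "bary y N = sum_list xs + q" "set xs \<subseteq> inner_coords" "q \<in> nat_lattice"
      using Suc.IH[of y] by (auto simp: generated_semigroup_def)
    have sum: "bary x (Suc N) = sum_list xs + q + bary a 1"
      using bary_add[of y a N 1] by (simp add: y(3) xs(1) add.commute)
    show ?case
    proof (cases "a \<in> range \<beta>")
      case True
      then obtain i where "a = \<beta> i" by auto
      then have "bary x (Suc N) = sum_list xs + (q + axis i 1)"
        unfolding sum by (simp add: bary_vertex)
      moreover have "q + axis i 1 \<in> nat_lattice"
        using xs(3) by (intro nat_lattice_add) (auto simp: nat_lattice_def axis_def)
      ultimately show ?thesis using xs(2) unfolding generated_semigroup_def by blast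
    next
      case False
      then have "set (bary a 1 # xs) \<subseteq> inner_coords" using y(2) xs(2) by (auto simp: inner_coords_def)
      moreover have "bary x (Suc N) = sum_list (bary a 1 # xs) + q" unfolding sum by simp
      ultimately show ?thesis using xs(3) unfolding generated_semigroup_def by blast
    qed
  qed
next
  assume "bary x (real N) \<in> generated_semigroup inner_coords"
  then obtain xs q where xs: "bary x N = sum_list xs + q" "set xs \<subseteq> inner_coords" "q \<in> nat_lattice"
    by (auto simp: generated_semigroup_def)
  \<comment> \<open>The vectors that satisfy \<open>W\<close> form a semigroup, which contains all generators.\<close>
  define W where "W c \<longleftrightarrow> (\<exists>n. height c = real n \<and> point c \<in> sumset n A)" for c
  have W0: "W 0"
    by (auto simp: W_def linear_0[OF linear_point] linear_0[OF linear_height] intro!: exI[of _ 0] zero_in_sumset)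
  have Wadd: "W (c + c')" if cc: "W c" "W c'" for c c'
  proof -
    obtain n n' where "height c = real n" "point c \<in> sumset n A" "height c' = real n'" "point c' \<in> sumset n' A"
      using cc by (auto simp: W_def)
    then show ?thesis
      by (auto simp: W_def linear_add[OF linear_point] linear_add[OF linear_height] intro!: exI[of _ "n + n'"] sumset_add)
  qed
  have WA: "W (of_nat k *\<^sub>R bary a 1)" if "a \<in> A" for a k
    using sumset_multiple[OF that, of k]
    by (auto simp: W_def linear_scale[OF linear_point] linear_scale[OF linear_height] intro!: exI[of _ k])
  have "W (sum_list xs)" using xs(2)
  proof (induction xs)
    case (Cons t xs)
    then obtain a where "a \<in> A" "t = bary a 1" by (auto simp: inner_coords_def)
    with WA[of a 1] Cons show ?case by (auto intro: Wadd)
  qed (simp add: W0)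
  moreover have "W q"
  proof -
    have "\<forall>i. \<exists>k :: nat. q $ i = real k" using xs(3) by (auto simp: nat_lattice_def elim!: Nats_cases)
    then obtain k where k: "\<And>i. q $ i = real (k i)" by metis
    have "W (\<Sum>i\<in>I. real (k i) *\<^sub>R bary (\<beta> i) 1)" if "finite I" for I
      using that by (induction I) (use W0 Wadd WA \<beta>_A in \<open>auto simp: image_subset_iff\<close>)
    moreover have "(\<Sum>i\<in>UNIV. real (k i) *\<^sub>R bary (\<beta> i) 1) = q"
      by (simp add: bary_vertex k[symmetric] vec_eq_iff axis_def if_distrib cong: if_cong)
    ultimately show ?thesis by (metis finite)
  qed
  ultimately have "W (bary x N)" unfolding xs(1) by (rule Wadd)
  then show "x \<in> sumset N A" by (auto simp: W_def)
qed

text \<open>The vector \<open>real N *\<^sub>R \<beta> i - x\<close> lies in the cone and in the group generated by \<open>\<beta> i - A\<close>.  As it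
  is not exceptional, it is a sum of \<open>M\<close> elements of \<open>\<beta> i - A\<close> for some \<open>M\<close>; adding \<open>M\<close>
  copies of the vertex to \<open>x\<close> then gives a sum of \<open>M + N\<close> elements of \<open>A\<close>.\<close>

lemma saturated_point_lifts:
  assumes "a\<^sub>0 \<in> A" "x = real N *\<^sub>R y" "y \<in> convex hull A"
    and "x - real N *\<^sub>R a\<^sub>0 \<in> group_closure (diff_set A)"
    and notin: "\<And>e. e \<in> exceptional_set ((\<lambda>a'. \<beta> i - a') ` A) \<Longrightarrow> x \<noteq> real N *\<^sub>R \<beta> i - e"
  shows "\<exists>j. bary x (real N) + of_nat j *\<^sub>R axis i 1 \<in> generated_semigroup inner_coords"
proof -
  define e where "e = real N *\<^sub>R \<beta> i - x"
  define S where "S = (\<lambda>a'. \<beta> i - a') ` A"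
  have "e \<in> nonneg_cone S"
  proof -
    obtain u where u: "\<forall>a\<in>A. 0 \<le> u a" "sum u A = 1" "(\<Sum>a\<in>A. u a *\<^sub>R a) = y"
      using assms(3) finite_A by (auto simp: convex_hull_finite)
    have "e = real N *\<^sub>R (sum u A *\<^sub>R \<beta> i - (\<Sum>a\<in>A. u a *\<^sub>R a))"
      by (simp add: e_def assms(2) u algebra_simps)
    also have "\<dots> = (\<Sum>a\<in>A. (real N * u a) *\<^sub>R (\<beta> i - a))"
      by (simp add: scaleR_sum_right scaleR_sum_left sum_subtractf algebra_simps)
    also have "\<dots> = (\<Sum>s\<in>S. (real N * u (\<beta> i - s)) *\<^sub>R s)"
      unfolding S_def by (subst sum.reindex) (auto simp: inj_on_def)
    finally show ?thesis
      using u(1) unfolding nonneg_cone_def S_def by (auto intro!: exI[of _ "\<lambda>s. real N * u (\<beta> i - s)"])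
  qed
  moreover have "e \<in> group_closure S"
  proof -
    have S: "\<beta> i - a \<in> group_closure S" if "a \<in> A" for a
      using that by (intro group_closure.base) (auto simp: S_def)
    have "diff_set A \<subseteq> group_closure S"
    proof
      fix d assume "d \<in> diff_set A"
      then obtain a a' where "a \<in> A" "a' \<in> A" "d = (\<beta> i - a') - (\<beta> i - a)" by (auto simp: diff_set_def)
      then show "d \<in> group_closure S" using group_closure.diff[OF S S] by metis
    qed
    from group_closure_subgroup[OF this assms(4)]
    have "real N *\<^sub>R (\<beta> i - a\<^sub>0) - (x - real N *\<^sub>R a\<^sub>0) \<in> group_closure S"
      by (rule group_closure.diff[OF group_closure_scaleR[OF S[OF assms(1)]]])
    then show ?thesis by (simp add: e_def algebra_simps)
  qed
  moreover have "e \<notin> exceptional_set S" using notin[of e] by (auto simp: e_def S_def)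
  ultimately obtain M where "e \<in> sumset M S" by (auto simp: exceptional_set_def all_sumsets_def)
  then have y: "of_nat M *\<^sub>R \<beta> i - e \<in> sumset M A" unfolding S_def by (subst (asm) sumset_reflect)
  have "x + of_nat M *\<^sub>R \<beta> i = (of_nat M *\<^sub>R \<beta> i - e) + real N *\<^sub>R \<beta> i" by (simp add: e_def)
  also have "\<dots> \<in> sumset (M + N) A" using y \<beta>_A by (intro sumset_add sumset_multiple) auto
  finally have "bary (x + of_nat M *\<^sub>R \<beta> i) (real (M + N)) \<in> generated_semigroup inner_coords"
    by (simp only: sumset_iff_semigroup)
  moreover have "bary (x + of_nat M *\<^sub>R \<beta> i) (real (M + N)) = bary x N + of_nat M *\<^sub>R axis i 1"
    using bary_add[of x "of_nat M *\<^sub>R \<beta> i" N M] bary_scaleR[of M "\<beta> i" 1] 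
    by (simp add: bary_vertex add.commute)
  ultimately show ?thesis by metis
qed

lemma sumset_structure_if_high:
  assumes "a\<^sub>0 \<in> A" "N \<ge> 1"
    and N: "real N \<ge> fact (CARD('n) + 1) * measure lebesgue (convex hull A)
                      - (real CARD('n) + 1) * (real (card A) - real CARD('n))
      \<or> card A \<le> CARD('n) + 2"
  shows "sumset_structure A a\<^sub>0 N"
  unfolding sumset_structure_def
proof (intro equalityI subsetI)
  fix x assume "x \<in> ((\<lambda>x. real N *\<^sub>R x) ` (convex hull A) \<inter>
        (\<lambda>x. real N *\<^sub>R a\<^sub>0 + x) ` group_closure (diff_set A)) -
       (\<Union>a \<in> hull_extremal_points A.
          (\<lambda>e. real N *\<^sub>R a - e) ` exceptional_set ((\<lambda>a'. a - a') ` A))"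
  then have "\<exists>y. x = real N *\<^sub>R y \<and> y \<in> convex hull A"
    and gr: "x - real N *\<^sub>R a\<^sub>0 \<in> group_closure (diff_set A)"
    and notin: "\<And>a e. a \<in> hull_extremal_points A \<Longrightarrow>
      e \<in> exceptional_set ((\<lambda>a'. a - a') ` A) \<Longrightarrow> x \<noteq> real N *\<^sub>R a - e"
    by auto
  then obtain y where y: "x = real N *\<^sub>R y" "y \<in> convex hull A" by blast
  have ex: "\<exists>j. bary x (real N) + of_nat j *\<^sub>R axis i 1 \<in> generated_semigroup inner_coords" for i
    by (rule saturated_point_lifts[OF assms(1) y gr notin]) (use vertex_extremal in auto)
  have nonneg: "0 \<le> bary x (real N) $ i" for i
    using bary_hull_nonneg[OF y(2), of i] bary_scaleR[of N y 1] by (simp add: y(1))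
  from N have "bary x (real N) \<in> generated_semigroup inner_coords"
  proof
    assume big: "real N \<ge> fact (CARD('n) + 1) * measure lebesgue (convex hull A)
                      - (real CARD('n) + 1) * (real (card A) - real CARD('n))"
    let ?m = "fact CARD('n) * measure lebesgue (convex hull A)"
    have "real CARD('n option) * (?m - real (card inner_coords) - 1) =
        (real CARD('n) + 1) * ?m - (real CARD('n) + 1) * (real (card A) - real CARD('n))"
      by (simp add: card_inner_coords[symmetric] algebra_simps)
    also have "\<dots> \<le> (\<Sum>i\<in>UNIV. bary x (real N) $ i)"
      using big height_bary[of x "real N"] by (simp add: height_def algebra_simps)
    finally show ?thesis
      using in_generated_semigroup_if_high[OF finite_inner_coords fractional_inner_coords
          inner_coords_subset_integral_points zero_in_integral_points integral_points_add
          card_incongruent_le_volume nonneg _ ex] by blast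
  next
    assume "card A \<le> CARD('n) + 2"
    then have "card inner_coords \<le> Suc 0" using card_inner_coords by simp
    then obtain t where "inner_coords \<subseteq> {t}"
      using finite_inner_coords by (metis card_le_Suc0_iff_eq insert_iff subsetI)
    from in_generated_semigroup_if_one_generator[OF fractional_inner_coords this _ ex] show ?thesis by simp
  qed
  then show "x \<in> sumset N A" by (simp add: sumset_iff_semigroup)
qed (use sumset_subset_structure[OF assms(1,2)] in blast)

end

section \<open>The structure of sumsets of a simplex\<close>

theorem theorem1p5:
  fixes A :: "(real ^ 'n) set" and a\<^sub>0 :: "real ^ 'n"
  assumes "finite A" and "A \<subseteq> int_lattice"
    and "hull_is_full_simplex A"
    and "a\<^sub>0 \<in> A"
  shows "(\<forall>N::nat. N \<ge> 1 \<longrightarrow>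
            real N \<ge> fact (CARD('n) + 1) * measure lebesgue (convex hull A)
                      - (real CARD('n) + 1) * (real (card A) - real CARD('n)) \<longrightarrow>
            sumset_structure A a\<^sub>0 N) \<and>
         (card A = CARD('n) + 1 \<or> card A = CARD('n) + 2 \<longrightarrow>
            (\<forall>N::nat. N \<ge> 1 \<longrightarrow> sumset_structure A a\<^sub>0 N))"
proof -
  obtain B where B: "B \<subseteq> A" "finite B" "card B = CARD('n) + 1" "span (diff_set B) = UNIV"
      "convex hull A = convex hull B"
    using assms(3) by (auto simp: hull_is_full_simplex_def)
  have "\<exists>\<beta>. bij_betw \<beta> (UNIV :: 'n option set) B"
    using B(2,3) by (intro finite_same_card_bij) auto
  then obtain \<beta> :: "'n option \<Rightarrow> real ^ 'n" where \<beta>: "inj \<beta>" "range \<beta> = B"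
    by (auto simp: bij_betw_def)
  interpret lattice_simplex A \<beta>
    by unfold_locales (use assms B \<beta> in auto)
  show ?thesis using sumset_structure_if_high[OF assms(4)] by auto
qed

end
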